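(* Let $G$ be a graph on $n$ vertices with $n\geq 90$. If $G$ is triangle-free and $d_2(G)\geq 4$, then $$e(G)\leq \left\lfloor\frac{(n-4)^2}{4}\right\rfloor+16.$$
   Context: All graphs are finite, simple and undirected. $e(G)$ denotes the number of edges of $G$. A graph is triangle-free if it contains no $K_3$ as a subgraph. For $T\subseteq V(G)$, $G-T$ denotes the subgraph of $G$ induced by $V(G)\setminus T$. Define $$d_2(G)=\min\{|T| : T\subseteq V(G),\ G-T \text{ is bipartite}\}.$$ *)

theory Defs
  imports Complex_Main
begin

text \<open>A graph is a pair of a vertex set and a set of edges, each edge being an
  unordered pair of distinct vertices; this excludes loops and multiple edges.\<close>

type_synonym 'a graph = "'a set \<times> 'a set set"

abbreviation verts :: "'a graph \<Rightarrow> 'a set" where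
  "verts G \<equiv> fst G"

abbreviation edges :: "'a graph \<Rightarrow> 'a set set" where
  "edges G \<equiv> snd G"

definition finite_simple_graph :: "'a graph \<Rightarrow> bool" where
  "finite_simple_graph G \<longleftrightarrow>
     finite (verts G) \<and> (\<forall>e\<in>edges G. e \<subseteq> verts G \<and> card e = 2)"

definition triangle_free :: "'a graph \<Rightarrow> bool" where
  "triangle_free G \<longleftrightarrow>
     \<not> (\<exists>x\<in>verts G. \<exists>y\<in>verts G. \<exists>z\<in>verts G. x \<noteq> y \<and> y \<noteq> z \<and> x \<noteq> z \<and>
          {x, y} \<in> edges G \<and> {y, z} \<in> edges G \<and> {x, z} \<in> edges G)"

text \<open>Either side of the bipartition may be empty, so that edgeless graphs
  (including the graph without vertices) are bipartite.\<close>

definition bipartite :: "'a graph \<Rightarrow> bool" where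
  "bipartite G \<longleftrightarrow>
     (\<exists>A B. A \<union> B = verts G \<and> A \<inter> B = {} \<and>
        (\<forall>e\<in>edges G. \<exists>a\<in>A. \<exists>b\<in>B. e = {a, b}))"

definition delete_verts :: "'a graph \<Rightarrow> 'a set \<Rightarrow> 'a graph" where
  "delete_verts G T = (verts G - T, {e \<in> edges G. e \<subseteq> verts G - T})"

definition d2 :: "'a graph \<Rightarrow> nat" where
  "d2 G = Min (card ` {T. T \<subseteq> verts G \<and> bipartite (delete_verts G T)})"

text \<open>The minimum in \<open>d2\<close> is taken over a finite nonempty set.\<close>

lemma d2_candidates:
  assumes "finite_simple_graph G"
  shows "finite {T. T \<subseteq> verts G \<and> bipartite (delete_verts G T)}"
    and "verts G \<in> {T. T \<subseteq> verts G \<and> bipartite (delete_verts G T)}"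
  using assms by (auto simp: finite_simple_graph_def bipartite_def delete_verts_def)

end

theory Submission
  imports Defs
begin

text \<open>
  The number that controls everything is the largest size \<open>n - k\<close> of a union \<open>X \<union> Y\<close> of two
  disjoint independent sets, so that \<open>k = d\<^sub>2(G) \<ge> 4\<close>. Two bounds, valid for every \<open>k\<close>, cover
  the large and the small values of \<open>k\<close>.

  \<^item> Let \<open>v\<close> have maximum degree \<open>\<Delta>\<close>. A neighbour \<open>b\<close> of \<open>v\<close> has at most \<open>n - k - \<Delta>\<close> neighbours,
    because \<open>N(v)\<close> and \<open>N(b)\<close> are disjoint independent sets, and the other \<open>n - \<Delta>\<close> vertices have
    at most \<open>\<Delta>\<close> neighbours each. Hence \<open>2e(G) \<le> \<Delta>(2n - 2\<Delta> - k)\<close>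
    (\<open>sum_deg_le_max_degree\<close>), which suffices if \<open>k \<ge> 8\<close>.

  \<^item> Always \<open>e(G) \<le> |X||Y| + k\<^sup>2\<close> (\<open>sum_deg_le_product_plus_square\<close>). As
    \<open>|X| + |Y| = n - k\<close>, this suffices if \<open>4 \<le> k \<le> 7\<close>.

  For the second bound, distribute the \<open>k\<close> vertices outside \<open>X \<union> Y\<close> over the two sides, \<open>p\<close> of
  them to \<open>X\<close> and \<open>q\<close> of them to \<open>Y\<close>, so that the resulting cut \<open>(A, B)\<close> has as many edges as
  possible. Maximality of \<open>|X| + |Y|\<close> makes \<open>X\<close> a maximum independent set of \<open>A\<close> and \<open>Y\<close> one of
  \<open>B\<close>. A neighbourhood is independent, so a vertex of \<open>B\<close> misses at least \<open>p\<close> vertices of \<open>A\<close>, and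
  a vertex of \<open>A\<close> misses at least \<open>q\<close> vertices of \<open>B\<close>. If these two kinds of non-edges were always
  different, the cut would have at most \<open>|X||Y| - pq\<close> edges. To control the coincidences, one
  confines the non-edges to small cores: by an argument of Hajnal, \<open>A\<close> contains a set of at most
  \<open>2p\<close> vertices in which every independent set already misses \<open>p\<close> vertices
  (\<open>exists_small_core\<close>). This leaves at most \<open>|X||Y| + pq\<close> edges in the cut, and every vertex \<open>t\<close>
  improves the bound further, since no edge joins its neighbours on one side to those on the
  other (\<open>cut_size_bound\<close>). The edges inside \<open>A\<close> and inside \<open>B\<close> number at most \<open>k M\<close>, where \<open>M\<close>
  is the largest number of neighbours that one of the \<open>k\<close> distributed vertices has on its own side.
  If \<open>M\<close> is small, \<open>k M + pq\<close> is at most \<open>k\<^sup>2\<close>; if \<open>M\<close> is large, the vertex attaining it has at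
  least \<open>M\<close> neighbours on either side, and the improvement that it brings makes up for the excess.
\<close>

section \<open>Neighbourhoods and independent sets\<close>

lemma exists_maximiser:
  fixes f :: "'b \<Rightarrow> 'c::linorder"
  assumes "finite S" "S \<noteq> {}"
  obtains x where "x \<in> S" "\<And>y. y \<in> S \<Longrightarrow> f y \<le> f x"
proof -
  have "Max (f ` S) \<in> f ` S" using assms by (intro Max_in) auto
  then obtain x where "x \<in> S" "f x = Max (f ` S)" by auto
  then show thesis using that[of x] assms(1) by simp
qed

text \<open>Applying the second axiom to a loop shows that there is none.\<close>

locale triangle_free_adjacency =
  fixes adj :: "'a \<Rightarrow> 'a \<Rightarrow> bool"
  assumes adj_sym: "adj x y \<Longrightarrow> adj y x"
    and no_triangle: "adj x y \<Longrightarrow> adj y z \<Longrightarrow> \<not> adj x z"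
begin

definition nbrs :: "'a set \<Rightarrow> 'a \<Rightarrow> 'a set" where
  "nbrs S v = {u \<in> S. adj v u}"

abbreviation deg :: "'a set \<Rightarrow> 'a \<Rightarrow> nat" where
  "deg S v \<equiv> card (nbrs S v)"

definition indep :: "'a set \<Rightarrow> bool" where
  "indep S \<longleftrightarrow> (\<forall>x\<in>S. \<forall>y\<in>S. \<not> adj x y)"

lemma not_adj_self: "\<not> adj x x"
  using no_triangle by blast

lemma adj_commute: "adj x y \<longleftrightarrow> adj y x"
  using adj_sym by blast

lemma nbrs_subset: "nbrs S v \<subseteq> S"
  by (auto simp: nbrs_def)

lemma finite_nbrs: "finite S \<Longrightarrow> finite (nbrs S v)"
  by (simp add: nbrs_def)

lemma indep_nbrs: "indep (nbrs S v)"
  unfolding indep_def nbrs_def using no_triangle adj_sym by blast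

lemma indep_subset: "indep S \<Longrightarrow> R \<subseteq> S \<Longrightarrow> indep R"
  unfolding indep_def by blast

lemma deg_Un_disjoint:
  assumes "finite R" "finite S" "R \<inter> S = {}"
  shows "deg (R \<union> S) v = deg R v + deg S v"
proof -
  have "nbrs (R \<union> S) v = nbrs R v \<union> nbrs S v" by (auto simp: nbrs_def)
  moreover have "nbrs R v \<inter> nbrs S v = {}" using assms(3) by (auto simp: nbrs_def)
  ultimately show ?thesis using assms by (simp add: card_Un_disjoint finite_nbrs)
qed

lemma deg_eq_sum:
  assumes "finite S"
  shows "deg S v = (\<Sum>u\<in>S. if adj v u then 1 else 0)"
  using assms by (simp add: nbrs_def sum.If_cases Int_def)

lemma sum_deg_swap:
  assumes "finite A" "finite B"
  shows "(\<Sum>a\<in>A. deg B a) = (\<Sum>b\<in>B. deg A b)"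
proof -
  have "(\<Sum>a\<in>A. deg B a) = (\<Sum>a\<in>A. \<Sum>b\<in>B. if adj a b then 1 else 0)"
    using assms by (simp add: deg_eq_sum)
  also have "\<dots> = (\<Sum>b\<in>B. \<Sum>a\<in>A. if adj a b then 1 else 0)" by (rule sum.swap)
  also have "\<dots> = (\<Sum>b\<in>B. deg A b)"
    using assms by (simp add: deg_eq_sum adj_commute)
  finally show ?thesis .
qed

section \<open>A small core that forces non-neighbours\<close>

text \<open>Hajnal's inequality. When a maximum independent set \<open>I\<close> joins the family, with union \<open>U\<close>
  and intersection \<open>Z\<close>, no edge runs between \<open>Z\<close> and \<open>U\<close>, as every vertex of \<open>U\<close> shares a member
  of the family with all of \<open>Z\<close>. Therefore \<open>(I \<inter> U) \<union> Z\<close> is independent.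
  Comparing its size with that of \<open>I\<close> shows that the intersection loses no more elements than the
  union gains.\<close>

lemma card_Union_Inter_max_indep:
  assumes "finite F" "F \<noteq> {}" "finite W"
    and max: "\<And>I. I \<subseteq> W \<Longrightarrow> indep I \<Longrightarrow> card I \<le> m"
    and F: "\<And>I. I \<in> F \<Longrightarrow> I \<subseteq> W \<and> indep I \<and> card I = m"
  shows "2 * m \<le> card (\<Union>F) + card (\<Inter>F)"
  using assms(1,2) F
proof (induction F rule: finite_ne_induct)
  case (singleton I)
  then show ?case by simp
next
  case (insert I F)
  let ?U = "\<Union>F" and ?Z = "\<Inter>F"
  have I: "I \<subseteq> W" "indep I" "card I = m" using insert.prems by auto
  have FW: "\<And>J. J \<in> F \<Longrightarrow> J \<subseteq> W \<and> indep J \<and> card J = m" using insert.prems by auto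
  have IH: "2 * m \<le> card ?U + card ?Z" using insert.IH FW by auto
  have UW: "?U \<subseteq> W" using FW by auto
  have ZU: "?Z \<subseteq> ?U" using insert.hyps by auto
  have fin: "finite I" "finite ?U" "finite ?Z"
    using I(1) UW ZU \<open>finite W\<close> by (auto dest: finite_subset)
  have no_ZU: "\<not> adj z u" if "z \<in> ?Z" "u \<in> ?U" for z u
    using that FW unfolding indep_def by blast
  have "indep ((I \<inter> ?U) \<union> (?Z - I))"
    unfolding indep_def
  proof (intro ballI)
    fix a b assume ab: "a \<in> (I \<inter> ?U) \<union> (?Z - I)" "b \<in> (I \<inter> ?U) \<union> (?Z - I)"
    show "\<not> adj a b"
    proof (cases "a \<in> I \<and> b \<in> I")
      case True
      then show ?thesis using I(2) by (auto simp: indep_def)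
    next
      case False
      then have "(a \<in> ?Z \<and> b \<in> ?U) \<or> (b \<in> ?Z \<and> a \<in> ?U)" using ab ZU by blast
      then show ?thesis using no_ZU adj_sym by blast
    qed
  qed
  then have "card ((I \<inter> ?U) \<union> (?Z - I)) \<le> m"
    by (rule max[rotated]) (use I(1) UW ZU in auto)
  moreover have "card ((I \<inter> ?U) \<union> (?Z - I)) = card (I \<inter> ?U) + card (?Z - I)"
    using fin by (intro card_Un_disjoint) auto
  moreover have "card I = card (I \<inter> ?U) + card (I - ?U)"
    using fin(1) by (metis card_Int_Diff)
  ultimately have "card (?Z - I) \<le> card (I - ?U)" using I(3) by linarith
  moreover have "card ?Z = card (?Z \<inter> I) + card (?Z - I)"
    using fin(3) by (rule card_Int_Diff)
  moreover have "card (I \<union> ?U) = card ?U + card (I - ?U)"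
    using fin by (metis Un_Diff_cancel Un_commute card_Un_disjoint Diff_disjoint finite_Diff)
  moreover have "\<Union>(insert I F) = I \<union> ?U" "\<Inter>(insert I F) = ?Z \<inter> I" by auto
  ultimately show ?case using IH by simp
qed

text \<open>Shrink \<open>X\<close> to a minimal \<open>X'\<close> that is still maximum independent in the set that remains. By
  minimality, every \<open>x \<in> X'\<close> is avoided by some maximum independent set. Together with \<open>X'\<close>, these
  sets have empty intersection, so by Hajnal's inequality they cover at least \<open>2|X'|\<close> vertices;
  but only \<open>|A - X| + |X'|\<close> are available.

  In the core \<open>(A - X) \<union> X'\<close>, every independent set misses at least \<open>|A - X|\<close> vertices, just
  as in \<open>A\<close> itself.\<close>

lemma exists_small_core:
  assumes "finite A" "X \<subseteq> A" "indep X"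
    and max: "\<And>I. I \<subseteq> A \<Longrightarrow> indep I \<Longrightarrow> card I \<le> card X"
  obtains X' where "X' \<subseteq> X" "card X' \<le> card (A - X)"
    "\<And>I. I \<subseteq> (A - X) \<union> X' \<Longrightarrow> indep I \<Longrightarrow> card I \<le> card X'"
proof -
  define core where "core Z \<longleftrightarrow>
    Z \<subseteq> X \<and> (\<forall>I. I \<subseteq> (A - X) \<union> Z \<longrightarrow> indep I \<longrightarrow> card I \<le> card Z)" for Z
  have "(A - X) \<union> X = A" using assms(2) by auto
  then have "core X" using max by (simp add: core_def)
  then obtain X' where "core X'" and least: "\<And>Z. core Z \<Longrightarrow> card X' \<le> card Z"
    using ex_has_least_nat[of core X card] by blast
  let ?P = "A - X"
  have good: "X' \<subseteq> X" "\<And>I. I \<subseteq> ?P \<union> X' \<Longrightarrow> indep I \<Longrightarrow> card I \<le> card X'"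
    using \<open>core X'\<close> by (simp_all add: core_def)
  have fin: "finite ?P" "finite X'"
    using good(1) assms(1,2) by (auto intro: finite_subset)
  have "\<exists>I. I \<subseteq> ?P \<union> (X' - {x}) \<and> indep I \<and> card I = card X'" if "x \<in> X'" for x
  proof -
    have smaller: "card (X' - {x}) < card X'" using that fin(2) by (meson card_Diff1_less)
    then have "\<not> card X' \<le> card (X' - {x})" by simp
    then have "\<not> core (X' - {x})" using least by blast
    moreover have "X' - {x} \<subseteq> X" using good(1) by blast
    ultimately obtain I where I: "I \<subseteq> ?P \<union> (X' - {x})" "indep I" "card (X' - {x}) < card I"
      by (auto simp: not_le core_def)
    moreover have "card I \<le> card X'" using I(1,2) by (intro good(2)) auto
    moreover have "card (X' - {x}) = card X' - 1" using that fin(2) by simp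
    ultimately show ?thesis using smaller by (intro exI[of _ I]) linarith
  qed
  then obtain f where f: "\<And>x. x \<in> X' \<Longrightarrow> f x \<subseteq> ?P \<union> (X' - {x}) \<and> indep (f x) \<and> card (f x) = card X'"
    by metis
  let ?F = "insert X' (f ` X')"
  have "indep X'" by (rule indep_subset[OF assms(3) good(1)])
  then have "2 * card X' \<le> card (\<Union>?F) + card (\<Inter>?F)"
    using fin good f
    by (intro card_Union_Inter_max_indep[where W = "?P \<union> X'"]) auto
  moreover have "\<Inter>?F = {}"
  proof -
    have "x \<notin> f x" if "x \<in> X'" for x
      using f[OF that] that good(1) by auto
    then show ?thesis by auto
  qed
  moreover have "card (\<Union>?F) \<le> card (?P \<union> X')"
    using f fin by (intro card_mono) auto
  moreover have "card (?P \<union> X') \<le> card ?P + card X'" by (rule card_Un_le)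
  ultimately have "card X' \<le> card ?P" by simp
  then show thesis by (rule that[OF good(1) _ good(2)])
qed

section \<open>The size of a cut\<close>

text \<open>With \<open>W\<^sub>A = P \<union> X'\<close> and \<open>W\<^sub>B = Q \<union> Y'\<close> the cores of the two sides, where \<open>P = A - X\<close> and
  \<open>Q = B - Y\<close>, count the edges of the cut at \<open>W\<^sub>A\<close>, then those between \<open>X - X'\<close> and \<open>W\<^sub>B\<close>, then the
  others. A vertex of \<open>B\<close> has at most \<open>|X'|\<close> neighbours in \<open>W\<^sub>A\<close>, and a vertex of \<open>A\<close> has at most
  \<open>|Y'|\<close> neighbours in \<open>W\<^sub>B\<close>, so that there are at most
  \<open>|X'||B| + |X - X'||Y'| + |X - X'||Y - Y'| = |X||Y| + |X'||Q|\<close> edges. Among the pairs of the last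
  group, those of two neighbours of \<open>t\<close> are not edges; outside the cores \<open>t\<close> keeps at least
  \<open>deg A t - |P|\<close> and \<open>deg B t - |Q|\<close> neighbours, where the differences are truncated at \<open>0\<close>.\<close>

lemma cut_size_bound:
  assumes fin: "finite A" "finite B"
    and X: "X \<subseteq> A" "indep X" "\<And>I. I \<subseteq> A \<Longrightarrow> indep I \<Longrightarrow> card I \<le> card X"
    and Y: "Y \<subseteq> B" "indep Y" "\<And>I. I \<subseteq> B \<Longrightarrow> indep I \<Longrightarrow> card I \<le> card Y"
  shows "(\<Sum>a\<in>A. deg B a) + (deg A t - card (A - X)) * (deg B t - card (B - Y))
    \<le> card X * card Y + card (A - X) * card (B - Y)"
proof -
  obtain X' where X': "X' \<subseteq> X" "card X' \<le> card (A - X)"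
    "\<And>I. I \<subseteq> (A - X) \<union> X' \<Longrightarrow> indep I \<Longrightarrow> card I \<le> card X'"
    using exists_small_core[OF fin(1) X] by blast
  obtain Y' where Y': "Y' \<subseteq> Y" "card Y' \<le> card (B - Y)"
    "\<And>I. I \<subseteq> (B - Y) \<union> Y' \<Longrightarrow> indep I \<Longrightarrow> card I \<le> card Y'"
    using exists_small_core[OF fin(2) Y] by blast
  define WA where "WA = (A - X) \<union> X'"
  define WB where "WB = (B - Y) \<union> Y'"
  have A: "A = WA \<union> (X - X')" "WA \<inter> (X - X') = {}" and B: "B = WB \<union> (Y - Y')" "WB \<inter> (Y - Y') = {}"
    using X(1) Y(1) X'(1) Y'(1) by (auto simp: WA_def WB_def)
  have finW: "finite WA" "finite (X - X')" "finite WB" "finite (Y - Y')" "finite X" "finite Y"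
    using A(1) B(1) X(1) Y(1) fin by (auto dest: finite_subset simp: WA_def WB_def
        finite_subset[OF X'(1)] finite_subset[OF Y'(1)])
  have degWA: "deg WA v \<le> card X'" for v
    using X'(3)[OF nbrs_subset indep_nbrs] by (simp add: WA_def)
  have degWB: "deg WB v \<le> card Y'" for v
    using Y'(3)[OF nbrs_subset indep_nbrs] by (simp add: WB_def)
  have degA: "deg A v = deg WA v + deg (X - X') v" for v
    using deg_Un_disjoint[OF finW(1,2) A(2)] A(1) by metis
  have degB: "deg B v = deg WB v + deg (Y - Y') v" for v
    using deg_Un_disjoint[OF finW(3,4) B(2)] B(1) by metis
  let ?U = "nbrs (X - X') t" and ?Z = "nbrs (Y - Y') t"
  have "(\<Sum>a\<in>A. deg B a) = (\<Sum>a\<in>WA. deg B a) + (\<Sum>a\<in>X - X'. deg B a)"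
    using sum.union_disjoint[OF finW(1,2) A(2), of "deg B"] A(1) by metis
  also have "\<dots> = (\<Sum>b\<in>B. deg WA b) + (\<Sum>a\<in>X - X'. deg WB a) + (\<Sum>a\<in>X - X'. deg (Y - Y') a)"
    using sum_deg_swap[OF finW(1) fin(2)] by (simp add: degB sum.distrib)
  finally have split: "(\<Sum>a\<in>A. deg B a) = \<dots>" .
  have first: "(\<Sum>b\<in>B. deg WA b) \<le> card B * card X'"
    using sum_bounded_above[of B "deg WA" "card X'"] degWA by simp
  have second: "(\<Sum>a\<in>X - X'. deg WB a) \<le> card (X - X') * card Y'"
    using sum_bounded_above[of "X - X'" "deg WB" "card Y'"] degWB by simp
  have third: "(\<Sum>a\<in>X - X'. deg (Y - Y') a) + card ?U * card ?Z \<le> card (X - X') * card (Y - Y')"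
  proof -
    have "deg (Y - Y') a + (if a \<in> ?U then card ?Z else 0) \<le> card (Y - Y')" for a
    proof (cases "a \<in> ?U")
      case True
      have "nbrs (Y - Y') a \<inter> ?Z = {}"
        using True no_triangle by (auto simp: nbrs_def)
      then have "deg (Y - Y') a + card ?Z = card (nbrs (Y - Y') a \<union> ?Z)"
        using finW(4) by (simp add: card_Un_disjoint finite_nbrs)
      also have "\<dots> \<le> card (Y - Y')"
        by (intro card_mono Un_least nbrs_subset finW(4))
      finally show ?thesis using True by simp
    next
      case False
      then show ?thesis using card_mono[OF finW(4) nbrs_subset] by simp
    qed
    then have "(\<Sum>a\<in>X - X'. deg (Y - Y') a + (if a \<in> ?U then card ?Z else 0))
        \<le> card (X - X') * card (Y - Y')"
      using sum_bounded_above[of "X - X'" "\<lambda>a. deg (Y - Y') a + (if a \<in> ?U then card ?Z else 0)"] by simp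
    moreover have "(X - X') \<inter> ?U = ?U" using nbrs_subset[of "X - X'" t] by auto
    ultimately show ?thesis
      using finW(2) by (simp add: sum.distrib flip: sum.inter_restrict)
  qed
  have "deg A t - card (A - X) \<le> card ?U" "deg B t - card (B - Y) \<le> card ?Z"
    using degA[of t] degB[of t] degWA[of t] degWB[of t] X'(2) Y'(2) by linarith+
  then have "(deg A t - card (A - X)) * (deg B t - card (B - Y)) \<le> card ?U * card ?Z"
    by (rule mult_le_mono)
  with split first second third
  have "(\<Sum>a\<in>A. deg B a) + (deg A t - card (A - X)) * (deg B t - card (B - Y))
    \<le> card B * card X' + card (X - X') * card Y' + card (X - X') * card (Y - Y')"
    by linarith
  also have "\<dots> = card X * card Y + card X' * card (B - Y)"
  proof -
    have cX: "card X = card X' + card (X - X')" and cY: "card Y = card Y' + card (Y - Y')"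
      using X'(1) Y'(1) finW(5,6)
      by (simp_all add: card_Diff_subset card_mono finite_subset)
    have cB: "card B = card (B - Y) + card Y"
      using Y(1) finW(6) fin(2) by (simp add: card_Diff_subset card_mono)
    show ?thesis unfolding cB unfolding cX cY by (simp add: algebra_simps)
  qed
  also have "\<dots> \<le> card X * card Y + card (A - X) * card (B - Y)"
    using X'(2) by simp
  finally show ?thesis .
qed

section \<open>The bound by a product plus a square\<close>

text \<open>The numbers \<open>M\<close> and \<open>g\<close> stand for the degrees of a vertex \<open>t\<close> into its own side and into the
  other one, so that the product on the right is what \<open>t\<close> saves in \<open>cut_size_bound\<close>.

  If \<open>M \<ge> p\<close> and \<open>g \<ge> q\<close>, put \<open>M = p + i\<close> and \<open>g = q + j\<close>. The claim becomes
  \<open>i (p + q - j) \<le> q\<^sup>2\<close>. If the second factor is positive, this follows from the inequality of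
  arithmetic and geometric means, as \<open>M \<le> g\<close> says that the factors have sum at most \<open>2q\<close>. In the
  other cases \<open>M \<le> p\<close> or \<open>M \<le> q\<close>, and \<open>(p + q)\<^sup>2\<close> alone is large enough.\<close>

lemma bad_edges_compensated:
  fixes p q M g :: nat
  assumes "M \<le> g"
  shows "(p + q) * M + p * q \<le> (p + q)\<^sup>2 + (M - p) * (g - q)"
proof (cases "p \<le> M \<and> q \<le> g")
  case True
  then obtain i j where ij: "M = p + i" "g = q + j" by (auto simp: le_iff_add)
  have "i * (p + q) \<le> q\<^sup>2 + i * j"
  proof (cases "p + q \<le> j")
    case True
    then show ?thesis by (simp add: mult_le_mono2 trans_le_add2)
  next
    case False
    then obtain d where d: "p + q = j + d" by (metis le_iff_add linear)
    then have "d + i \<le> 2 * q" using assms ij by linarith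
    then have "(d + i)\<^sup>2 \<le> (2 * q)\<^sup>2" by (rule power_mono) simp
    moreover have "4 * (i * d) \<le> (d + i)\<^sup>2"
    proof -
      have "0 \<le> (int d - int i)\<^sup>2" by simp
      then have "int (4 * (i * d)) \<le> int ((d + i)\<^sup>2)"
        by (simp add: power2_eq_square algebra_simps)
      then show ?thesis by (simp only: of_nat_le_iff)
    qed
    ultimately have "i * d \<le> q\<^sup>2" by (simp add: power2_eq_square)
    then show ?thesis unfolding d by (simp add: algebra_simps)
  qed
  then show ?thesis unfolding ij by (simp add: power2_eq_square algebra_simps)
next
  case False
  then have "M \<le> p \<or> M \<le> q" using assms by linarith
  then have "(p + q) * M + p * q \<le> (p + q)\<^sup>2"
  proof
    assume "M \<le> p"
    then have "(p + q) * M \<le> (p + q) * p" by simp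
    then show ?thesis by (simp add: power2_eq_square algebra_simps)
  next
    assume "M \<le> q"
    then have "(p + q) * M \<le> (p + q) * q" by simp
    then show ?thesis by (simp add: power2_eq_square algebra_simps)
  qed
  then show ?thesis by simp
qed

text \<open>Distribute \<open>T\<close> over the two sides so as to maximise the cut. Moving one vertex to the other
  side cannot improve it, so every vertex of \<open>T\<close> has at least as many neighbours across the cut as
  on its own side.\<close>

lemma exists_locally_maximal_cut:
  assumes fin: "finite X" "finite Y" "finite T"
    and disj: "X \<inter> Y = {}" "X \<inter> T = {}" "Y \<inter> T = {}"
  obtains P Q where "P \<union> Q = T" "P \<inter> Q = {}"
    "\<And>t. t \<in> P \<Longrightarrow> deg (X \<union> P) t \<le> deg (Y \<union> Q) t"
    "\<And>t. t \<in> Q \<Longrightarrow> deg (Y \<union> Q) t \<le> deg (X \<union> P) t"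
proof -
  let ?cut = "\<lambda>P. \<Sum>a\<in>X \<union> P. deg (Y \<union> (T - P)) a"
  have "finite (Pow T)" "Pow T \<noteq> {}" using fin(3) by auto
  then obtain P where "P \<in> Pow T" and "\<And>R. R \<in> Pow T \<Longrightarrow> ?cut R \<le> ?cut P"
    using exists_maximiser[of "Pow T" ?cut] by blast
  then have P: "P \<subseteq> T" and best: "\<And>R. R \<subseteq> T \<Longrightarrow> ?cut R \<le> ?cut P" by auto
  have no_self: "deg (insert t S) t = deg S t" for t S
    using not_adj_self by (auto simp: nbrs_def intro!: arg_cong[where f = card])
  have deg_insert: "deg (insert t S) v = deg S v + deg {t} v" if "t \<notin> S" "finite S" for t S v
    using deg_Un_disjoint[of S "{t}" v] that by simp
  have sum_deg_singleton: "(\<Sum>a\<in>S. deg {t} a) = deg S t" if "finite S" for S t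
    using sum_deg_swap[of S "{t}"] that by simp
  have swap: "(\<Sum>a\<in>insert t A. deg B a) + deg A t = (\<Sum>a\<in>A. deg (insert t B) a) + deg B t"
    if "t \<notin> A" "t \<notin> B" "finite A" "finite B" for t A B
    using that by (simp add: deg_insert[OF that(2,4)] sum.distrib sum_deg_singleton)
  show thesis
  proof (rule that[of P "T - P"])
    show "P \<union> (T - P) = T" "P \<inter> (T - P) = {}" using P by auto
    show "deg (X \<union> P) t \<le> deg (Y \<union> (T - P)) t" if t: "t \<in> P" for t
    proof -
      let ?A = "X \<union> (P - {t})" and ?B = "Y \<union> (T - P)"
      have eqs: "X \<union> P = insert t ?A" "insert t ?B = Y \<union> (T - (P - {t}))" using t P by auto
      have "t \<notin> ?A" "t \<notin> ?B" using t P disj by auto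
      moreover have "finite ?A" "finite ?B" using fin P by (auto intro: finite_subset)
      ultimately have "?cut P + deg ?A t = ?cut (P - {t}) + deg ?B t"
        using swap[of t ?A ?B] unfolding eqs by simp
      moreover have "?cut (P - {t}) \<le> ?cut P" using P by (intro best) auto
      moreover have "deg (X \<union> P) t = deg ?A t" unfolding eqs by (rule no_self)
      ultimately show ?thesis by linarith
    qed
    show "deg (Y \<union> (T - P)) t \<le> deg (X \<union> P) t" if t: "t \<in> T - P" for t
    proof -
      let ?A = "X \<union> P" and ?B = "Y \<union> (T - insert t P)"
      have eqs: "X \<union> insert t P = insert t ?A" "Y \<union> (T - P) = insert t ?B" using t by auto
      have "t \<notin> ?A" "t \<notin> ?B" using t P disj by auto
      moreover have "finite ?A" "finite ?B" using fin P by (auto intro: finite_subset)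
      ultimately have "?cut (insert t P) + deg ?A t = ?cut P + deg ?B t"
        using swap[of t ?A ?B] unfolding eqs by simp
      moreover have "?cut (insert t P) \<le> ?cut P" using P t by (intro best) auto
      moreover have "deg (Y \<union> (T - P)) t = deg ?B t" unfolding eqs by (rule no_self)
      ultimately show ?thesis by linarith
    qed
  qed
qed

lemma sum_deg_own_side:
  assumes "finite X" "finite P" "X \<inter> P = {}" "indep X"
  shows "(\<Sum>a\<in>X \<union> P. deg (X \<union> P) a) \<le> 2 * (\<Sum>a\<in>P. deg (X \<union> P) a)"
proof -
  have degs: "deg (X \<union> P) a = deg X a + deg P a" for a
    by (rule deg_Un_disjoint[OF assms(1,2,3)])
  have "nbrs X a = {}" if "a \<in> X" for a
    using that assms(4) by (auto simp: nbrs_def indep_def)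
  then have "(\<Sum>a\<in>X. deg (X \<union> P) a) = (\<Sum>a\<in>X. deg P a)" by (simp add: degs)
  also have "\<dots> = (\<Sum>a\<in>P. deg X a)" by (rule sum_deg_swap[OF assms(1,2)])
  also have "\<dots> \<le> (\<Sum>a\<in>P. deg (X \<union> P) a)" by (rule sum_mono) (simp add: degs)
  finally show ?thesis using sum.union_disjoint[OF assms(1,2,3), of "deg (X \<union> P)"] by simp
qed

text \<open>An independent subset of \<open>A = X \<union> P\<close> together with \<open>Y\<close> competes with \<open>X\<close> and \<open>Y\<close>; therefore \<open>X\<close>
  is a maximum independent set of \<open>A\<close>, and \<open>Y\<close> of \<open>B = Y \<union> Q\<close>, for every distribution of \<open>T\<close>. This
  is what the bound on the cut needs. It is applied to the vertex of \<open>T\<close> with the most neighbours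
  on its own side.\<close>

lemma sum_deg_le_product_plus_square:
  assumes fin: "finite X" "finite Y" "finite T"
    and disj: "X \<inter> Y = {}" "X \<inter> T = {}" "Y \<inter> T = {}"
    and XY: "indep X" "indep Y"
    and max: "\<And>I J. I \<subseteq> X \<union> Y \<union> T \<Longrightarrow> J \<subseteq> X \<union> Y \<union> T \<Longrightarrow> I \<inter> J = {} \<Longrightarrow> indep I \<Longrightarrow> indep J
      \<Longrightarrow> card I + card J \<le> card X + card Y"
  shows "(\<Sum>v\<in>X \<union> Y \<union> T. deg (X \<union> Y \<union> T) v) \<le> 2 * (card X * card Y + (card T)\<^sup>2)"
proof -
  obtain P Q where PQ: "P \<union> Q = T" "P \<inter> Q = {}"
    and local_P: "\<And>t. t \<in> P \<Longrightarrow> deg (X \<union> P) t \<le> deg (Y \<union> Q) t"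
    and local_Q: "\<And>t. t \<in> Q \<Longrightarrow> deg (Y \<union> Q) t \<le> deg (X \<union> P) t"
    using exists_locally_maximal_cut[OF fin disj] by blast
  define A where "A = X \<union> P"
  define B where "B = Y \<union> Q"
  have finPQ: "finite P" "finite Q" "finite A" "finite B"
    using fin PQ(1) by (auto simp: A_def B_def)
  have AB: "X \<union> Y \<union> T = A \<union> B" "A \<inter> B = {}"
    using PQ disj by (auto simp: A_def B_def)
  have diffs: "A - X = P" "B - Y = Q" using PQ disj by (auto simp: A_def B_def)
  have maxA: "card I \<le> card X" if "I \<subseteq> A" "indep I" for I
  proof -
    have "card I + card Y \<le> card X + card Y"
      using that XY(2) AB by (intro max) (auto simp: B_def)
    then show ?thesis by simp
  qed
  have maxB: "card I \<le> card Y" if "I \<subseteq> B" "indep I" for I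
  proof -
    have "card X + card I \<le> card X + card Y"
      using that XY(1) AB by (intro max) (auto simp: A_def)
    then show ?thesis by simp
  qed
  have cut: "(\<Sum>a\<in>A. deg B a) + (deg A t - card P) * (deg B t - card Q)
      \<le> card X * card Y + card P * card Q" for t
    using cut_size_bound[OF finPQ(3,4) _ XY(1) maxA _ XY(2) maxB, of t] diffs
    by (simp add: A_def B_def)
  have cardT: "card T = card P + card Q"
    using PQ finPQ(1,2) by (metis card_Un_disjoint)
  define own where "own t = (if t \<in> P then deg A t else deg B t)" for t
  have own_sum: "(\<Sum>t\<in>P. deg A t) + (\<Sum>t\<in>Q. deg B t) = (\<Sum>t\<in>T. own t)"
  proof -
    have "(\<Sum>t\<in>T. own t) = (\<Sum>t\<in>P. own t) + (\<Sum>t\<in>Q. own t)"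
      using sum.union_disjoint[OF finPQ(1,2) PQ(2)] PQ(1) by metis
    moreover have "(\<Sum>t\<in>Q. own t) = (\<Sum>t\<in>Q. deg B t)"
      using PQ(2) by (intro sum.cong) (auto simp: own_def)
    ultimately show ?thesis by (simp add: own_def)
  qed
  have "(\<Sum>v\<in>X \<union> Y \<union> T. deg (X \<union> Y \<union> T) v)
      = (\<Sum>v\<in>A. deg A v + deg B v) + (\<Sum>v\<in>B. deg A v + deg B v)"
    unfolding AB(1) using sum.union_disjoint[OF finPQ(3,4) AB(2)]
    by (simp add: deg_Un_disjoint[OF finPQ(3,4) AB(2)])
  also have "\<dots> = 2 * (\<Sum>a\<in>A. deg B a) + (\<Sum>a\<in>A. deg A a) + (\<Sum>b\<in>B. deg B b)"
    using sum_deg_swap[OF finPQ(3,4)] by (simp add: sum.distrib)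
  also have "\<dots> \<le> 2 * ((\<Sum>a\<in>A. deg B a) + (\<Sum>t\<in>T. own t))"
  proof -
    have "(\<Sum>a\<in>A. deg A a) \<le> 2 * (\<Sum>t\<in>P. deg A t)"
      unfolding A_def using fin finPQ disj PQ XY by (intro sum_deg_own_side) auto
    moreover have "(\<Sum>b\<in>B. deg B b) \<le> 2 * (\<Sum>t\<in>Q. deg B t)"
      unfolding B_def using fin finPQ disj PQ XY by (intro sum_deg_own_side) auto
    ultimately show ?thesis using own_sum by simp
  qed
  also have "(\<Sum>a\<in>A. deg B a) + (\<Sum>t\<in>T. own t) \<le> card X * card Y + (card T)\<^sup>2"
  proof (cases "T = {}")
    case True
    then have "P = {}" "Q = {}" using PQ by auto
    then show ?thesis using cut[THEN add_leD1] True by simp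
  next
    case False
    then obtain t where t: "t \<in> T" and t_max: "\<And>s. s \<in> T \<Longrightarrow> own s \<le> own t"
      using exists_maximiser[OF fin(3), of own] by blast
    have own_le: "(\<Sum>t\<in>T. own t) \<le> card T * own t"
      using sum_bounded_above[of T own "own t"] t_max by simp
    show ?thesis
    proof (cases "t \<in> P")
      case True
      then have "own t = deg A t" "deg A t \<le> deg B t"
        using local_P by (simp_all add: own_def A_def B_def)
      then have "card T * own t + card P * card Q
          \<le> (card T)\<^sup>2 + (deg A t - card P) * (deg B t - card Q)"
        using bad_edges_compensated[of "deg A t" "deg B t" "card P" "card Q"] cardT by simp
      then show ?thesis using cut[of t] own_le by linarith
    next
      case False
      then have "own t = deg B t" "deg B t \<le> deg A t"
        using local_Q t PQ(1) by (auto simp: own_def A_def B_def)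
      then have "card T * own t + card P * card Q
          \<le> (card T)\<^sup>2 + (deg A t - card P) * (deg B t - card Q)"
        using bad_edges_compensated[of "deg B t" "deg A t" "card Q" "card P"] cardT
        by (simp add: mult.commute add.commute)
      then show ?thesis using cut[of t] own_le by linarith
    qed
  qed
  finally show ?thesis by simp
qed

section \<open>The bound by the maximum degree\<close>

lemma sum_deg_le_max_degree:
  assumes fin: "finite V" and "V \<noteq> {}"
    and max: "\<And>I J. I \<subseteq> V \<Longrightarrow> J \<subseteq> V \<Longrightarrow> I \<inter> J = {} \<Longrightarrow> indep I \<Longrightarrow> indep J
      \<Longrightarrow> card I + card J + k \<le> card V"
  obtains d where "int (\<Sum>v\<in>V. deg V v) \<le> int d * (2 * int (card V) - 2 * int d - int k)"
proof -
  obtain v where v: "v \<in> V" and v_max: "\<And>u. u \<in> V \<Longrightarrow> deg V u \<le> deg V v"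
    by (rule exists_maximiser[OF fin \<open>V \<noteq> {}\<close>, where f = "deg V"]) auto
  let ?B = "nbrs V v"
  have BV: "?B \<subseteq> V" "finite ?B" by (simp_all add: nbrs_subset finite_nbrs fin)
  have near: "int (deg V b) \<le> int (card V) - int (deg V v) - int k" if "b \<in> ?B" for b
  proof -
    have "adj v b" using that by (simp add: nbrs_def)
    then have "nbrs V b \<inter> ?B = {}" using no_triangle by (auto simp: nbrs_def)
    then have "deg V b + card ?B + k \<le> card V"
      by (intro max nbrs_subset indep_nbrs)
    then show ?thesis by linarith
  qed
  have "int (\<Sum>v\<in>V. deg V v) = (\<Sum>u\<in>V - ?B. int (deg V u)) + (\<Sum>u\<in>?B. int (deg V u))"
    using sum.subset_diff[OF BV(1) fin, of "\<lambda>u. int (deg V u)"] by simp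
  also have "(\<Sum>u\<in>V - ?B. int (deg V u)) \<le> int (card (V - ?B)) * int (deg V v)"
    using sum_bounded_above[of "V - ?B" "\<lambda>u. int (deg V u)" "int (deg V v)"] v_max by simp
  also have "(\<Sum>u\<in>?B. int (deg V u))
      \<le> int (card ?B) * (int (card V) - int (deg V v) - int k)"
    using sum_bounded_above[of ?B "\<lambda>u. int (deg V u)"] near by simp
  also have "int (card (V - ?B)) = int (card V) - int (deg V v)"
    using BV fin by (simp add: card_Diff_subset card_mono of_nat_diff)
  finally have "int (\<Sum>v\<in>V. deg V v)
      \<le> int (deg V v) * (2 * int (card V) - 2 * int (deg V v) - int k)"
    by (simp add: algebra_simps)
  then show thesis by (rule that)
qed

end

section \<open>Graphs given by sets of edges\<close>

lemma triangle_free_adjacency_graph: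
  assumes "finite_simple_graph G" "triangle_free G"
  shows "triangle_free_adjacency (\<lambda>x y. {x, y} \<in> edges G)"
proof
  show "{y, x} \<in> edges G" if "{x, y} \<in> edges G" for x y
    using that by (simp add: insert_commute)
  have ends: "x \<in> verts G" "y \<in> verts G" "x \<noteq> y" if "{x, y} \<in> edges G" for x y
    using that assms(1) by (force simp: finite_simple_graph_def)+
  show "{x, z} \<notin> edges G" if "{x, y} \<in> edges G" "{y, z} \<in> edges G" for x y z
    using that ends assms(2) unfolding triangle_free_def by metis
qed

lemma handshake:
  assumes "finite_simple_graph G"
  shows "(\<Sum>v\<in>verts G. card {u \<in> verts G. {v, u} \<in> edges G}) = 2 * card (edges G)"
proof -
  let ?V = "verts G" and ?E = "edges G"
  have finV: "finite ?V" and E: "\<And>e. e \<in> ?E \<Longrightarrow> e \<subseteq> ?V \<and> card e = 2"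
    using assms by (auto simp: finite_simple_graph_def)
  have finE: "finite ?E" using E finV by (meson Pow_iff finite_Pow_iff finite_subset subsetI)
  have "card {u \<in> ?V. {v, u} \<in> ?E} = card {e \<in> ?E. v \<in> e}" for v
  proof (rule bij_betw_same_card[where f = "\<lambda>u. {v, u}"], rule bij_betwI')
    fix e assume "e \<in> {e \<in> ?E. v \<in> e}"
    then have "e \<in> ?E" "v \<in> e" "card e = 2" using E by auto
    then obtain u where "e = {v, u}" by (auto simp: card_2_iff doubleton_eq_iff)
    then show "\<exists>u\<in>{u \<in> ?V. {v, u} \<in> ?E}. e = {v, u}" using \<open>e \<in> ?E\<close> E by auto
  qed (auto simp: doubleton_eq_iff)
  then have "(\<Sum>v\<in>?V. card {u \<in> ?V. {v, u} \<in> ?E}) = (\<Sum>v\<in>?V. card {e \<in> ?E. v \<in> e})" by simp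
  also have "\<dots> = (\<Sum>v\<in>?V. \<Sum>e\<in>?E. if v \<in> e then 1 else 0)"
    using finE by (simp add: sum.If_cases Int_def)
  also have "\<dots> = (\<Sum>e\<in>?E. \<Sum>v\<in>?V. if v \<in> e then 1 else 0)" by (rule sum.swap)
  also have "\<dots> = (\<Sum>e\<in>?E. 2)"
  proof (rule sum.cong[OF refl])
    fix e assume "e \<in> ?E"
    then have "?V \<inter> e = e" "card e = 2" using E by auto
    then show "(\<Sum>v\<in>?V. if v \<in> e then 1 else 0) = (2 :: nat)"
      using finV by (simp add: sum.If_cases)
  qed
  finally show ?thesis by simp
qed

lemma d2_le_disjoint_indep:
  assumes G: "finite_simple_graph G"
    and IJ: "I \<subseteq> verts G" "J \<subseteq> verts G" "I \<inter> J = {}"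
    and indep: "\<And>x y. x \<in> I \<Longrightarrow> y \<in> I \<Longrightarrow> {x, y} \<notin> edges G"
      "\<And>x y. x \<in> J \<Longrightarrow> y \<in> J \<Longrightarrow> {x, y} \<notin> edges G"
  shows "card I + card J + d2 G \<le> card (verts G)"
proof -
  let ?T = "verts G - (I \<union> J)"
  have finV: "finite (verts G)" using G by (simp add: finite_simple_graph_def)
  have rest: "verts G - ?T = I \<union> J" using IJ by auto
  have "bipartite (delete_verts G ?T)"
    unfolding bipartite_def delete_verts_def fst_conv snd_conv rest
  proof (intro exI conjI ballI)
    fix e assume "e \<in> {e \<in> edges G. e \<subseteq> I \<union> J}"
    then have e: "e \<in> edges G" "e \<subseteq> I \<union> J" "card e = 2"
      using G by (auto simp: finite_simple_graph_def)
    then obtain x y where xy: "e = {x, y}" by (auto simp: card_2_iff)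
    then have "(x \<in> I \<and> y \<in> J) \<or> (y \<in> I \<and> x \<in> J)" using e indep by blast
    then show "\<exists>a\<in>I. \<exists>b\<in>J. e = {a, b}" using xy by (auto simp: insert_commute)
  qed (use IJ in auto)
  then have "d2 G \<le> card ?T"
    unfolding d2_def using d2_candidates(1)[OF G] by (intro Min_le) auto
  also have "card ?T = card (verts G) - card (I \<union> J)"
    using IJ finV by (intro card_Diff_subset) (auto intro: finite_subset)
  also have "card (I \<union> J) = card I + card J"
    using IJ finV by (intro card_Un_disjoint) (auto intro: finite_subset)
  finally have "d2 G \<le> card (verts G) - (card I + card J)" .
  moreover have "card I + card J \<le> card (verts G)"
    using IJ finV by (metis Un_least card_Un_disjoint card_mono finite_subset)
  ultimately show ?thesis by linarith
qed

theorem theorem1p5: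
  fixes G :: "'a graph" and n :: nat
  assumes "finite_simple_graph G"
    and "card (verts G) = n"
    and "n \<ge> 90"
    and "triangle_free G"
    and "d2 G \<ge> 4"
  shows "int (card (edges G)) \<le> \<lfloor>(real n - 4)\<^sup>2 / 4\<rfloor> + 16"
proof -
  interpret triangle_free_adjacency "\<lambda>x y. {x, y} \<in> edges G"
    by (rule triangle_free_adjacency_graph[OF assms(1,4)])
  let ?V = "verts G" and ?e = "int (card (edges G))"
  have finV: "finite ?V" using assms(1) by (simp add: finite_simple_graph_def)
  have double: "(\<Sum>v\<in>?V. deg ?V v) = 2 * card (edges G)"
    using handshake[OF assms(1)] by (simp add: nbrs_def)
  define pairs where
    "pairs = {(I, J). I \<subseteq> ?V \<and> J \<subseteq> ?V \<and> I \<inter> J = {} \<and> indep I \<and> indep J}"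
  have pair_le: "card I + card J + 4 \<le> n" if "(I, J) \<in> pairs" for I J
    using d2_le_disjoint_indep[OF assms(1), of I J] that assms(2,5)
    by (simp add: indep_def pairs_def)
  have "pairs \<subseteq> Pow ?V \<times> Pow ?V" by (auto simp: pairs_def)
  then have "finite pairs" using finV by (simp add: finite_subset)
  moreover have "({}, {}) \<in> pairs" by (simp add: indep_def pairs_def)
  ultimately obtain XY where "XY \<in> pairs"
    and "\<And>IJ. IJ \<in> pairs \<Longrightarrow> card (fst IJ) + card (snd IJ) \<le> card (fst XY) + card (snd XY)"
    using exists_maximiser[of pairs "\<lambda>IJ. card (fst IJ) + card (snd IJ)"] by blast
  then obtain X Y where XY_pairs: "(X, Y) \<in> pairs"
    and max_pairs: "\<And>I J. (I, J) \<in> pairs \<Longrightarrow> card I + card J \<le> card X + card Y"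
    by (metis fst_conv prod.collapse snd_conv)
  have XY: "X \<subseteq> ?V" "Y \<subseteq> ?V" "X \<inter> Y = {}" "indep X" "indep Y"
    using XY_pairs by (auto simp: pairs_def)
  have max: "card I + card J \<le> card X + card Y"
    if "I \<subseteq> ?V" "J \<subseteq> ?V" "I \<inter> J = {}" "indep I" "indep J" for I J
    using that by (intro max_pairs) (simp add: pairs_def)
  define k where "k = n - (card X + card Y)"
  have k: "card X + card Y + k = n" "4 \<le> k" using pair_le[OF XY_pairs] by (simp_all add: k_def)
  have "4 * ?e \<le> (int n - 4)\<^sup>2 + 64"
  proof (cases "8 \<le> k")
    case True
    have "?V \<noteq> {}" using assms(2,3) by auto
    moreover have "card I + card J + k \<le> card ?V"
      if "I \<subseteq> ?V" "J \<subseteq> ?V" "I \<inter> J = {}" "indep I" "indep J" for I J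
      using max[of I J] that k(1) assms(2) by simp
    ultimately obtain d where d: "2 * ?e \<le> int d * (2 * int n - 2 * int d - int k)"
      using sum_deg_le_max_degree[OF finV, of k] double assms(2) by auto
    also have "\<dots> \<le> int d * (2 * int n - 2 * int d - 8)"
      using True by (intro mult_left_mono) auto
    finally have "4 * ?e \<le> 4 * (int d * (int n - 4 - int d))" by (simp add: algebra_simps)
    also have "\<dots> \<le> (int n - 4)\<^sup>2"
      using zero_le_power2[of "int n - 4 - 2 * int d"] by (simp add: power2_eq_square algebra_simps)
    finally show ?thesis by simp
  next
    case False
    define T where "T = ?V - (X \<union> Y)"
    have fin: "finite X" "finite Y" "finite T"
      using XY finV by (auto simp: T_def intro: finite_subset)
    have V: "?V = X \<union> Y \<union> T" "X \<inter> T = {}" "Y \<inter> T = {}" using XY by (auto simp: T_def)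
    have "card ?V = card X + card Y + card T"
      using XY V fin by (simp add: card_Un_disjoint Int_Un_distrib2)
    then have cardT: "card T = k" using k(1) assms(2) by linarith
    have "(\<Sum>v\<in>?V. deg ?V v) \<le> 2 * (card X * card Y + (card T)\<^sup>2)"
      unfolding V(1) using XY V max fin by (intro sum_deg_le_product_plus_square) auto
    then have "card (edges G) \<le> card X * card Y + k\<^sup>2" using double cardT by simp
    then have "?e \<le> int (card X * card Y + k\<^sup>2)" by (simp only: of_nat_le_iff)
    then have "4 * ?e \<le> 4 * (int (card X) * int (card Y)) + 4 * (int k)\<^sup>2" by simp
    also have "\<dots> \<le> (int (card X) + int (card Y))\<^sup>2 + 4 * (int k)\<^sup>2"
      using zero_le_power2[of "int (card X) - int (card Y)"]
      by (simp add: power2_eq_square algebra_simps)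
    also have "int (card X) + int (card Y) = int n - int k" using k(1) by linarith
    \<comment> \<open>Equality holds for \<open>k = 4\<close>; for larger \<open>k\<close>, the loss in the first square grows with \<open>n\<close>.\<close>
    also have "(int n - int k)\<^sup>2 + 4 * (int k)\<^sup>2 \<le> (int n - 4)\<^sup>2 + 64"
    proof -
      have "k = 4 \<or> k = 5 \<or> k = 6 \<or> k = 7" using k(2) False by linarith
      then show ?thesis using assms(3) by (auto simp: power2_eq_square algebra_simps)
    qed
    finally show ?thesis .
  qed
  then have "real_of_int (4 * ?e) \<le> real_of_int ((int n - 4)\<^sup>2 + 64)" by (simp only: of_int_le_iff)
  then have "real_of_int (?e - 16) \<le> (real n - 4)\<^sup>2 / 4" by simp
  then have "?e - 16 \<le> \<lfloor>(real n - 4)\<^sup>2 / 4\<rfloor>" by (simp only: le_floor_iff)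
  then show ?thesis by simp
qed

end
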